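(* Let $n\ge 1$, let $p_1,\ldots,p_n>0$ and $k>0$ be fixed, and let $p(\boldsymbol{x})=\sum_{i=1}^n p_i^2x_i^2$ for all $\boldsymbol{x}\in\mathbb{R}^n$. Put $$F_0(t)=\frac{\pi^{n/2}}{\Gamma(n/2+2)}\,t^{n/2+1},\qquad F(t)=\frac{F_0(t)}{p_1\cdots p_n}\qquad (t\ge 0).$$ Every hyperplane tangent to the paraboloid $z=p(\boldsymbol{x})+k^2$ cuts off from the paraboloid $z=p(\boldsymbol{x})$ an $(n+1)$-dimensional compact set of constant Euclidean volume equal to $F(k^2)$. Conversely, let $f\in C^{2}(\mathbb{R}^n)$ be a real-valued function such that $f(\boldsymbol{x})>p(\boldsymbol{x})$ for all $\boldsymbol{x}\in\mathbb{R}^n$. If every hyperplane tangent to the surface $z=f(\boldsymbol{x})$ cuts off from the paraboloid $z=p(\boldsymbol{x})$ a compact set of constant $(n+1)$-dimensional Euclidean volume $V$, then $f(\boldsymbol{x})=p(\boldsymbol{x})+k^2$ for all $\boldsymbol{x}\in\mathbb{R}^n$, where $k^2=F^{-1}(V)$.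
   Context: Points of the Euclidean space $E^{n+1}$ are written $(\boldsymbol{x},z)=(x_1,\ldots,x_n,z)$. The compact set cut off from the paraboloid $z=p(\boldsymbol{x})$ by a hyperplane $z=\sum_{i=1}^n m_ix_i+c$ is $\{(\boldsymbol{x},z): p(\boldsymbol{x})\le z\le \sum_{i=1}^n m_ix_i+c\}$. $\Gamma$ is the Euler Gamma function. In the converse part $k$ is defined by $V$ through $k^2=F^{-1}(V)$. *)

theory Defs
  imports "HOL-Analysis.Analysis"
begin

text \<open>
  The space \<open>E\<^sup>n\<^sup>+\<^sup>1\<close> is the Euclidean space \<open>(real^'n) \<times> real\<close>, with points \<open>(x, z)\<close> and
  \<open>n = CARD('n) \<ge> 1\<close>; its volume is Lebesgue measure. A non-vertical hyperplane
  \<open>z = m \<bullet> x + c\<close> is represented by its coefficients \<open>m\<close> and \<open>c\<close>.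
\<close>

definition paraboloid :: "real^'n \<Rightarrow> real^'n \<Rightarrow> real" where
  "paraboloid p x = (\<Sum>i\<in>UNIV. (p$i)\<^sup>2 * (x$i)\<^sup>2)"

definition hyperplane :: "real^'n \<Rightarrow> real \<Rightarrow> ((real^'n) \<times> real) set" where
  "hyperplane m c = {(x, z). z = m \<bullet> x + c}"

text \<open>
  A tangent hyperplane of the graph of a differentiable function is never vertical, so the
  coefficients \<open>(m, c)\<close> cover all of them.
\<close>

definition tangent_to_graph :: "(real^'n \<Rightarrow> real) \<Rightarrow> real^'n \<Rightarrow> real \<Rightarrow> bool" where
  "tangent_to_graph f m c \<longleftrightarrow>
     (\<exists>a. (a, f a) \<in> hyperplane m c \<and> (f has_derivative (\<lambda>h. m \<bullet> h)) (at a))"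

definition cut_off :: "(real^'n \<Rightarrow> real) \<Rightarrow> real^'n \<Rightarrow> real \<Rightarrow> ((real^'n) \<times> real) set" where
  "cut_off q m c = {(x, z). q x \<le> z \<and> z \<le> m \<bullet> x + c}"

definition C2 :: "('a::real_normed_vector \<Rightarrow> 'b::real_normed_vector) \<Rightarrow> bool" where
  "C2 f \<longleftrightarrow>
     (\<exists>(f' :: 'a \<Rightarrow> 'a \<Rightarrow>\<^sub>L 'b) (f'' :: 'a \<Rightarrow> 'a \<Rightarrow>\<^sub>L 'a \<Rightarrow>\<^sub>L 'b).
        (\<forall>x. (f has_derivative blinfun_apply (f' x)) (at x)) \<and>
        (\<forall>x. (f' has_derivative blinfun_apply (f'' x)) (at x)) \<and>
        continuous_on UNIV f'')"

definition F0 :: "nat \<Rightarrow> real \<Rightarrow> real" where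
  "F0 n t = pi powr (real n / 2) / Gamma (real n / 2 + 2) * t powr (real n / 2 + 1)"

definition F :: "real^'n \<Rightarrow> real \<Rightarrow> real" where
  "F p t = F0 CARD('n) t / (\<Prod>i\<in>UNIV. p$i)"

text \<open>
  \<open>F p\<close> is a bijection of the half-line \<open>t \<ge> 0\<close> onto itself, so \<open>inv_into {0..} (F p)\<close> is a
  genuine inverse there.
\<close>

lemma bij_betw_F:
  fixes p :: "real^'n"
  assumes "\<And>i. p$i > 0"
  shows "bij_betw (F p) {0..} {0..}"
proof -
  define e where "e = real CARD('n) / 2 + 1"
  define C where
    "C = pi powr (real CARD('n) / 2) / Gamma (real CARD('n) / 2 + 2) / (\<Prod>i\<in>UNIV. p$i)"
  have e: "e > 0" by (simp add: e_def)
  have "Gamma (real CARD('n) / 2 + 2) > 0" by (rule Gamma_real_pos) simp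
  moreover have "(\<Prod>i\<in>UNIV. p$i) > 0" using assms by (simp add: prod_pos)
  ultimately have C: "C > 0" by (simp add: C_def)
  have F: "F p t = C * t powr e" for t
    by (simp add: F_def F0_def C_def e_def)
  show ?thesis
  proof (rule bij_betw_byWitness[where f' = "\<lambda>y. (y / C) powr (1 / e)"])
    show "\<forall>t\<in>{0..}. (F p t / C) powr (1 / e) = t"
      using C e by (simp add: F powr_powr)
    show "\<forall>y\<in>{0..}. F p ((y / C) powr (1 / e)) = y"
      using C e by (simp add: F powr_powr)
  qed (use C in \<open>auto simp: F\<close>)
qed

end

theory Submission
  imports Defs
begin

text \<open>
  Completing the square, the body cut off by \<open>z = m \<bullet> x + c\<close> is an affine image of
  \<open>{(y, w). (norm y)\<^sup>2 \<le> w \<le> t}\<close>, where \<open>t\<close> is the value of \<open>m \<bullet> x + c - p(x)\<close> at its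
  maximum, so the volume is \<open>F(t)\<close> for \<open>t \<ge> 0\<close> and determines \<open>t\<close>. For the converse, all
  tangent planes of \<open>f\<close> therefore have the same \<open>t = k\<^sup>2\<close>. Evaluating at the point of contact gives
  \<open>f \<le> p + k\<^sup>2\<close>. Conversely, fix \<open>x\<close> and let \<open>m\<close> be the gradient of \<open>p\<close> at \<open>x\<close>; since
  \<open>f > p\<close>, the function \<open>f(y) - m \<bullet> y\<close> attains its minimum, and the tangent plane there,
  which is \<open>z = m \<bullet> y + c\<close> with \<open>m \<bullet> x + c = p(x) + k\<^sup>2\<close>, lies below the graph of \<open>f\<close>, so
  \<open>f(x) \<ge> p(x) + k\<^sup>2\<close>.
\<close>

section \<open>Completing the square in the gap between hyperplane and paraboloid\<close>

definition apex :: "real^'n \<Rightarrow> real^'n \<Rightarrow> real^'n" where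
  "apex p m = (\<chi> i. m$i / (2 * (p$i)\<^sup>2))"

text \<open>For nonzero \<open>p$i\<close>, the gradient of \<open>paraboloid p\<close> at
  \<open>a = apex p m\<close> is \<open>m\<close>, and
  \<open>m \<bullet> a = 2 * paraboloid p a\<close>. Hence this is the maximum over \<open>x\<close>
  of \<open>m \<bullet> x + c - paraboloid p x\<close>, attained at \<open>a\<close>.\<close>

definition height :: "real^'n \<Rightarrow> real^'n \<Rightarrow> real \<Rightarrow> real" where
  "height p m c = c + paraboloid p (apex p m)"

lemma paraboloid_nonneg: "paraboloid p x \<ge> 0"
  by (auto simp: paraboloid_def intro: sum_nonneg)

lemma paraboloid_0 [simp]: "paraboloid p 0 = 0"
  by (simp add: paraboloid_def)

lemma continuous_on_paraboloid [continuous_intros]: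
  "continuous_on S f \<Longrightarrow> continuous_on S (\<lambda>x. paraboloid p (f x))"
  unfolding paraboloid_def by (intro continuous_intros)

lemma paraboloid_conv_norm: "paraboloid p x = (norm (\<chi> i. p$i * x$i))\<^sup>2"
  by (simp add: paraboloid_def norm_vec_def L2_set_def sum_nonneg power_mult_distrib)

text \<open>Holds coordinatewise because \<open>m$i = 2 * (p$i)\<^sup>2 * apex p m $ i\<close>. It
  makes the gap over \<open>x\<close> depend only on the height and on the displacement from the
  apex.\<close>

lemma complete_square:
  fixes p :: "real^'n"
  assumes "\<And>i. p$i \<noteq> 0"
  shows "m \<bullet> x + c = paraboloid p x + height p m c - paraboloid p (x - apex p m)"
proof -
  have "m$i * x$i = (p$i)\<^sup>2 * (x$i)\<^sup>2 + (p$i)\<^sup>2 * (apex p m $ i)\<^sup>2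
          - (p$i)\<^sup>2 * ((x - apex p m)$i)\<^sup>2" for i
    using assms[of i] by (simp add: apex_def field_simps power2_eq_square)
  then show ?thesis
    by (simp add: height_def paraboloid_def inner_vec_def sum.distrib sum_subtractf)
qed

lemma paraboloid_has_derivative:
  "(paraboloid p has_derivative (\<lambda>h. (\<chi> i. 2 * (p$i)\<^sup>2 * a$i) \<bullet> h)) (at a)"
  unfolding paraboloid_def inner_vec_def
  by (auto intro!: derivative_eq_intros bounded_linear_imp_has_derivative bounded_linear_vec_nth
      simp: fun_eq_iff algebra_simps)

section \<open>Compactness and dimension of the cut-off set\<close>

lemma closed_cut_off: "closed (cut_off (paraboloid p) m c)"
proof -
  have "cut_off (paraboloid p) m c =
      {y. paraboloid p (fst y) \<le> snd y} \<inter> {y. snd y \<le> m \<bullet> fst y + c}"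
    by (auto simp: cut_off_def)
  also have "closed \<dots>"
    by (intro closed_Int closed_Collect_le continuous_intros)
  finally show ?thesis .
qed

lemma compact_cut_off:
  fixes p :: "real^'n"
  assumes "\<And>i. p$i \<noteq> 0"
  shows "compact (cut_off (paraboloid p) m c)"
proof -
  \<comment> \<open>\<open>T\<close> maps balls about the origin to ellipsoids about the apex, and
    \<open>w\<close> is the depth below the hyperplane. The image of a compact cylinder under
    \<open>\<Phi>\<close> then bounds the cut; for \<open>t < 0\<close> both sets are empty.\<close>
  define T where "T y = apex p m + (\<chi> i. y$i / p$i)" for y
  define \<Phi> where "\<Phi> = (\<lambda>(y, w). (T y, m \<bullet> T y + c - w))"
  define t where "t = height p m c"
  have cont_T: "continuous_on S T" for S
    unfolding T_def by (intro continuous_intros) (use assms in auto)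
  have "compact (\<Phi> ` (cball 0 (sqrt t) \<times> {0..t}))"
    unfolding \<Phi>_def case_prod_unfold
    by (intro compact_continuous_image compact_Times continuous_intros
          continuous_on_compose2[OF cont_T]) auto
  moreover have "cut_off (paraboloid p) m c \<subseteq> \<Phi> ` (cball 0 (sqrt t) \<times> {0..t})"
  proof (clarsimp simp: cut_off_def)
    fix x z assume *: "paraboloid p x \<le> z" "z \<le> m \<bullet> x + c"
    define y where "y = (\<chi> i. p$i * (x - apex p m)$i)"
    have "T y = x"
      using assms by (simp add: T_def y_def vec_eq_iff)
    moreover have "m \<bullet> x + c = paraboloid p x + t - (norm y)\<^sup>2"
      using complete_square[OF assms, where m = m and x = x and c = c]
      unfolding t_def y_def paraboloid_conv_norm[of p "x - apex p m"] by simp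
    moreover from this * have "(norm y)\<^sup>2 \<le> t"
      by linarith
    moreover from calculation * have "m \<bullet> x + c - z \<le> t"
      using zero_le_power2[of "norm y"] by linarith
    ultimately show "(x, z) \<in> \<Phi> ` (cball 0 (sqrt t) \<times> {0..t})"
      using * by (intro image_eqI[of _ _ "(y, m \<bullet> x + c - z)"]) (auto simp: \<Phi>_def real_le_rsqrt)
  qed
  ultimately show ?thesis
    using closed_cut_off bounded_subset compact_imp_bounded compact_eq_bounded_closed by blast
qed

lemma height_pos_if_above:
  fixes p :: "real^'n"
  assumes "\<And>i. p$i \<noteq> 0" "paraboloid p x < m \<bullet> x + c"
  shows "height p m c > 0"
  using complete_square[OF assms(1), where m = m and x = x and c = c] assms(2)
    paraboloid_nonneg[of p "x - apex p m"] by linarith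

lemma aff_dim_cut_off:
  fixes p :: "real^'n"
  assumes "\<And>i. p$i \<noteq> 0" "height p m c > 0"
  shows "aff_dim (cut_off (paraboloid p) m c) = int CARD('n) + 1"
proof -
  define U where "U = {y. paraboloid p (fst y) < snd y} \<inter> {y. snd y < m \<bullet> fst y + c}"
  have "open U"
    unfolding U_def by (intro open_Int open_Collect_less continuous_intros)
  moreover have "U \<subseteq> cut_off (paraboloid p) m c"
    by (auto simp: U_def cut_off_def)
  \<comment> \<open>The midpoint of the vertical segment of the cut over the apex, whose length is
    the height.\<close>
  moreover have "(apex p m, paraboloid p (apex p m) + height p m c / 2) \<in> U"
    using complete_square[OF assms(1), where m = m and x = "apex p m" and c = c] assms(2)
    by (simp add: U_def)
  ultimately have "interior (cut_off (paraboloid p) m c) \<noteq> {}"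
    by (metis empty_iff interior_maximal subset_empty)
  then show ?thesis
    using aff_dim_nonempty_interior by fastforce
qed

section \<open>Volume of the cut-off set\<close>

lemma prod_Basis_vec:
  fixes g :: "real^'n \<Rightarrow> 'b::comm_monoid_mult"
  shows "(\<Prod>j\<in>Basis. g j) = (\<Prod>i\<in>UNIV. g (axis i 1))"
proof -
  have "Basis = range (\<lambda>i::'n. axis i (1::real))"
    by (auto simp: Basis_vec_def)
  moreover have "inj (\<lambda>i::'n. axis i (1::real))"
    by (auto simp: inj_def axis_eq_axis)
  ultimately show ?thesis
    by (metis (no_types, lifting) prod.reindex_cong)
qed

text \<open>Change of variables by a diagonal affine map with Jacobian determinant
  \<open>1 / (\<Prod>i\<in>UNIV. p$i)\<close>. It reduces the elliptic paraboloid to the round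
  one.\<close>

lemma nn_integral_lborel_diagonal_affine:
  fixes p a :: "real^'n"
  assumes p: "\<And>i. p$i > 0" and g [measurable]: "g \<in> borel_measurable borel"
  shows "(\<integral>\<^sup>+x. g x \<partial>lborel) =
    ennreal (1 / (\<Prod>i\<in>UNIV. p$i)) * (\<integral>\<^sup>+y. g (a + (\<chi> i. y$i / p$i)) \<partial>lborel)"
proof -
  let ?T = "\<lambda>y::real^'n. a + (\<Sum>j\<in>Basis. (1 / (p \<bullet> j) * (y \<bullet> j)) *\<^sub>R j)"
  have T: "?T y = a + (\<chi> i. y$i / p$i)" for y
  proof -
    have "(\<Sum>j\<in>Basis. (1 / (p \<bullet> j) * (y \<bullet> j)) *\<^sub>R j) = (\<chi> i. y$i / p$i)"
    proof (rule euclidean_eqI)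
      fix b :: "real^'n"
      assume b: "b \<in> Basis"
      then obtain i where "b = axis i 1"
        by (auto simp: Basis_vec_def)
      with b show "(\<Sum>j\<in>Basis. (1 / (p \<bullet> j) * (y \<bullet> j)) *\<^sub>R j) \<bullet> b = (\<chi> i. y$i / p$i) \<bullet> b"
        by (simp only: inner_sum_left_Basis) (simp add: inner_axis)
    qed
    then show ?thesis by simp
  qed
  have T_meas [measurable]: "?T \<in> borel_measurable borel"
    by simp
  have "p \<bullet> j > 0" if "j \<in> Basis" for j
    using that p by (auto simp: Basis_vec_def inner_axis)
  then have "lborel = density (distr lborel borel ?T) (\<lambda>_. \<Prod>j\<in>Basis. \<bar>1 / (p \<bullet> j)\<bar>)"
    by (intro lborel_affine_euclidean) (metis divide_eq_0_iff less_irrefl zero_neq_one)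
  also have "(\<Prod>j\<in>Basis. \<bar>1 / (p \<bullet> j)\<bar>) = 1 / (\<Prod>i\<in>UNIV. p$i)"
    using p by (simp add: prod_Basis_vec inner_axis prod_dividef less_imp_le abs_of_pos)
  finally have "(\<integral>\<^sup>+x. g x \<partial>lborel) =
      (\<integral>\<^sup>+x. g x \<partial>density (distr lborel borel ?T) (\<lambda>_. ennreal (1 / (\<Prod>i\<in>UNIV. p$i))))"
    by simp
  also have "\<dots> = ennreal (1 / (\<Prod>i\<in>UNIV. p$i)) * (\<integral>\<^sup>+y. g (?T y) \<partial>lborel)"
    by (simp add: nn_integral_density nn_integral_cmult nn_integral_distr)
  finally show ?thesis
    unfolding T .
qed

text \<open>Both iterated integrals of the region \<open>(norm y)\<^sup>2 \<le> w \<le> t\<close>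
  agree: vertical segments give the left side, horizontal balls of radius \<open>sqrt w\<close> an
  elementary integral in \<open>w\<close>. Since \<open>ennreal\<close> sends negative numbers to 0,
  the integrand vanishes outside the ball of radius \<open>sqrt t\<close>.\<close>

lemma nn_integral_standard_cap:
  assumes "t \<ge> 0"
  shows "(\<integral>\<^sup>+y. ennreal (t - (norm (y::'a::euclidean_space))\<^sup>2) \<partial>lborel) = ennreal (F0 DIM('a) t)"
proof -
  let ?n = "real DIM('a)"
  let ?S = "{y::'a \<times> real. (norm (fst y))\<^sup>2 \<le> snd y} \<inter> {y. snd y \<le> t}"
  have "closed ?S"
    by (intro closed_Int closed_Collect_le continuous_intros)
  then have S: "?S \<in> sets (lborel \<Otimes>\<^sub>M lborel)"
    unfolding lborel_prod by (simp only: sets_lborel borel_closed)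
  have "(\<integral>\<^sup>+y. ennreal (t - (norm (y::'a))\<^sup>2) \<partial>lborel) = (\<integral>\<^sup>+y. emeasure lborel (Pair y -` ?S) \<partial>lborel)"
  proof (intro nn_integral_cong)
    fix y :: 'a
    have "Pair y -` ?S = {(norm y)\<^sup>2..t}" by auto
    then show "ennreal (t - (norm y)\<^sup>2) = emeasure lborel (Pair y -` ?S)"
      by (cases "(norm y)\<^sup>2 \<le> t") (auto simp: ennreal_neg)
  qed
  also have "\<dots> = emeasure (lborel \<Otimes>\<^sub>M lborel) ?S"
    using S by (simp add: lborel.emeasure_pair_measure_alt)
  also have "\<dots> = (\<integral>\<^sup>+w. emeasure lborel ((\<lambda>y. (y, w)) -` ?S) \<partial>lborel)"
    using S by (rule lborel_pair.emeasure_pair_measure_alt2)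
  also have "\<dots> = (\<integral>\<^sup>+w. ennreal (unit_ball_vol ?n * w powr (?n / 2)) * indicator {0..t} w \<partial>lborel)"
  proof (intro nn_integral_cong)
    fix w
    show "emeasure lborel ((\<lambda>y. (y, w)) -` ?S) =
        ennreal (unit_ball_vol ?n * w powr (?n / 2)) * indicator {0..t} w"
    proof (cases "w \<in> {0..t}")
      case True
      then have "(\<lambda>y. (y, w)) -` ?S = cball 0 (sqrt w)"
        by (auto simp: real_le_rsqrt dest: sqrt_le_D)
           (metis norm_ge_zero real_sqrt_le_iff real_sqrt_unique real_sqrt_pow2 power_mono)
      \<comment> \<open>At \<open>w = 0\<close> both sides are 0: the dimension is positive, and
        \<open>0 powr r = 0\<close> by convention.\<close>
      moreover have "sqrt w ^ DIM('a) = w powr (?n / 2)"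
        using True by (cases "w = 0") (auto simp: powr_half_sqrt[symmetric] powr_powr powr_realpow[symmetric])
      ultimately show ?thesis
        using True by (simp add: emeasure_cball)
    next
      case False
      then have "(\<lambda>y. (y, w)) -` ?S = {}"
        by (auto simp: not_le) (metis not_less order_trans zero_le_power2)
      with False show ?thesis by simp
    qed
  qed
  also have "\<dots> = ennreal (unit_ball_vol ?n * (t powr (?n / 2 + 1) / (?n / 2 + 1)))"
    using assms
    by (intro nn_integral_has_integral_lebesgue' has_integral_mult_right has_integral_powr_from_0) auto
  \<comment> \<open>The divisor \<open>?n / 2 + 1\<close> from the integration is absorbed by the
    functional equation of Gamma.\<close>
  also have "unit_ball_vol ?n * (t powr (?n / 2 + 1) / (?n / 2 + 1)) = F0 DIM('a) t"
  proof -
    have "Gamma (?n / 2 + 2) = (?n / 2 + 1) * Gamma (?n / 2 + 1)"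
      using Gamma_plus1[of "?n / 2 + 1"] by (simp add: add_ac nonpos_Ints_def)
    then show ?thesis
      by (simp add: F0_def unit_ball_vol_def)
  qed
  finally show ?thesis .
qed

lemma measure_cut_off:
  fixes p :: "real^'n"
  assumes p: "\<And>i. p$i > 0" and t: "height p m c \<ge> 0"
  shows "measure lborel (cut_off (paraboloid p) m c) = F p (height p m c)"
proof -
  let ?S = "cut_off (paraboloid p) m c" and ?t = "height p m c"
  have nz: "p$i \<noteq> 0" for i
    using p[of i] by simp
  have [measurable]: "paraboloid p \<in> borel_measurable borel"
    by (intro borel_measurable_continuous_onI continuous_intros)
  have "?S \<in> sets (lborel \<Otimes>\<^sub>M lborel)"
    unfolding lborel_prod by (simp only: sets_lborel borel_closed closed_cut_off)
  then have "emeasure lborel ?S = (\<integral>\<^sup>+x. emeasure lborel (Pair x -` ?S) \<partial>lborel)"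
    by (simp add: lborel_prod[symmetric] lborel.emeasure_pair_measure_alt)
  also have "\<dots> = (\<integral>\<^sup>+x. ennreal (?t - paraboloid p (x - apex p m)) \<partial>lborel)"
  proof (intro nn_integral_cong)
    fix x
    have "Pair x -` ?S = {paraboloid p x..m \<bullet> x + c}"
      by (auto simp: cut_off_def)
    then show "emeasure lborel (Pair x -` ?S) = ennreal (?t - paraboloid p (x - apex p m))"
      using complete_square[OF nz, where m = m and x = x and c = c]
      by (cases "paraboloid p x \<le> m \<bullet> x + c") (auto simp: ennreal_neg)
  qed
  \<comment> \<open>With \<open>x = apex p m + y / p\<close> taken coordinatewise, the shifted
    paraboloid becomes \<open>(norm y)\<^sup>2\<close>.\<close>
  also have "\<dots> = ennreal (1 / (\<Prod>i\<in>UNIV. p$i)) * (\<integral>\<^sup>+y. ennreal (?t - (norm (y::real^'n))\<^sup>2) \<partial>lborel)"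
    using nz by (subst nn_integral_lborel_diagonal_affine[OF p, where a = "apex p m"], measurable)
      (simp add: paraboloid_conv_norm)
  also have "\<dots> = ennreal (F p ?t)"
    using p t by (simp add: nn_integral_standard_cap ennreal_mult'[symmetric] prod_nonneg less_imp_le F_def)
  finally have "measure lborel ?S = enn2real (ennreal (F p ?t))"
    by (simp add: measure_def)
  moreover have "F p ?t \<ge> 0"
    using bij_betw_F[of p] p t by (auto dest: bij_betwE)
  ultimately show ?thesis
    by simp
qed

section \<open>Tangent planes of the lifted paraboloid, and the converse by bounds from both
  sides\<close>

theorem theorem2:
  fixes p :: "real^'n"
  assumes "\<And>i. p$i > 0"
  shows
    "(\<forall>k>0. \<forall>m c. tangent_to_graph (\<lambda>x. paraboloid p x + k\<^sup>2) m c \<longrightarrow>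
        compact (cut_off (paraboloid p) m c) \<and>
        aff_dim (cut_off (paraboloid p) m c) = int CARD('n) + 1 \<and>
        measure lborel (cut_off (paraboloid p) m c) = F p (k\<^sup>2))
     \<and>
     (\<forall>(f :: real^'n \<Rightarrow> real) (V :: real).
        C2 f \<longrightarrow>
        (\<forall>x. f x > paraboloid p x) \<longrightarrow>
        (\<forall>m c. tangent_to_graph f m c \<longrightarrow>
           compact (cut_off (paraboloid p) m c) \<and>
           measure lborel (cut_off (paraboloid p) m c) = V) \<longrightarrow>
        (\<exists>k>0. k\<^sup>2 = inv_into {0..} (F p) V \<and> (\<forall>x. f x = paraboloid p x + k\<^sup>2)))"
proof (intro conjI allI impI)
  have nz: "p$i \<noteq> 0" for i
    using assms[of i] by simp
  note square = complete_square[OF nz]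
  {
    fix k :: real and m :: "real^'n" and c
    assume k: "k > 0" and "tangent_to_graph (\<lambda>x. paraboloid p x + k\<^sup>2) m c"
    then obtain a where a: "paraboloid p a + k\<^sup>2 = m \<bullet> a + c"
      and deriv: "((\<lambda>x. paraboloid p x + k\<^sup>2) has_derivative (\<lambda>h. m \<bullet> h)) (at a)"
      by (auto simp: tangent_to_graph_def hyperplane_def)
    have "((\<lambda>x. paraboloid p x + k\<^sup>2) has_derivative
        (\<lambda>h. (\<chi> i. 2 * (p$i)\<^sup>2 * a$i) \<bullet> h)) (at a)"
      by (auto intro!: derivative_eq_intros paraboloid_has_derivative)
    \<comment> \<open>Equal gradients force the point of contact to be the apex, where the gap is
      exactly \<open>k\<^sup>2\<close>.\<close>
    from has_derivative_unique[OF deriv this] have "m = (\<chi> i. 2 * (p$i)\<^sup>2 * a$i)"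
      by (metis vector_eq_rdot)
    then have "apex p m = a"
      using nz by (simp add: apex_def vec_eq_iff)
    then have t: "height p m c = k\<^sup>2"
      using square[of m a c] a by simp
    show "compact (cut_off (paraboloid p) m c)"
      by (rule compact_cut_off[OF nz])
    show "aff_dim (cut_off (paraboloid p) m c) = int CARD('n) + 1"
      using aff_dim_cut_off[OF nz] t k by simp
    show "measure lborel (cut_off (paraboloid p) m c) = F p (k\<^sup>2)"
      using measure_cut_off[OF assms, of m c] t by simp
  }
  fix f :: "real^'n \<Rightarrow> real" and V :: real
  assume "C2 f" and above: "\<forall>x. f x > paraboloid p x"
    and cut: "\<forall>m c. tangent_to_graph f m c \<longrightarrow>
      compact (cut_off (paraboloid p) m c) \<and> measure lborel (cut_off (paraboloid p) m c) = V"
  define t where "t = inv_into {0..} (F p) V"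
  have diff: "\<exists>m. (f has_derivative (\<lambda>h. m \<bullet> h)) (at x)" for x
  proof -
    obtain D where D: "(f has_derivative D) (at x)"
      using \<open>C2 f\<close> by (auto simp: C2_def)
    then have "linear D"
      by (rule has_derivative_linear)
    \<comment> \<open>The Riesz representation of the derivative: \<open>adjoint D 1\<close> is the
      gradient.\<close>
    then have "D = (\<lambda>h. adjoint D 1 \<bullet> h)"
      by (auto simp: fun_eq_iff inner_commute adjoint_works)
    with D show ?thesis
      by metis
  qed
  then have cont: "continuous_on S f" for S
    by (meson continuous_at_imp_continuous_on has_derivative_continuous)
  \<comment> \<open>The point of contact lies above the paraboloid, so the height is positive;
    injectivity of \<open>F p\<close> on \<open>{0..}\<close> then recovers it from
    \<open>V\<close>.\<close>
  have height: "height p m c = t \<and> t > 0"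
    if "(f has_derivative (\<lambda>h. m \<bullet> h)) (at a)" "f a = m \<bullet> a + c" for m a c
  proof -
    have "tangent_to_graph f m c"
      using that by (auto simp: tangent_to_graph_def hyperplane_def)
    moreover have pos: "height p m c > 0"
      using height_pos_if_above[OF nz, where x = a] above that(2) by metis
    ultimately have "V = F p (height p m c)"
      using cut measure_cut_off[OF assms, of m c] by simp
    with pos show ?thesis
      using bij_betw_F[OF assms] by (simp add: t_def bij_betw_def)
  qed
  have "t > 0"
    using diff[of 0] height[of _ 0 "f 0"] by auto
  have upper: "f x \<le> paraboloid p x + t" for x
  proof -
    obtain m where m: "(f has_derivative (\<lambda>h. m \<bullet> h)) (at x)"
      using diff by blast
    then have "height p m (f x - m \<bullet> x) = t"
      using height[of m x "f x - m \<bullet> x"] by simp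
    then show ?thesis
      using square[of m x "f x - m \<bullet> x"] paraboloid_nonneg[of p "x - apex p m"] by linarith
  qed
  have lower: "f x \<ge> paraboloid p x + t" for x
  proof -
    define m where "m = (\<chi> i. 2 * (p$i)\<^sup>2 * x$i)"
    define c where "c = f x - m \<bullet> x"
    \<comment> \<open>The projection of the cut made by the plane of slope \<open>m\<close> through
      \<open>(x, f x)\<close>. It is compact and contains \<open>x\<close>; outside it
      \<open>f z - m \<bullet> z\<close> exceeds \<open>c\<close>, its value at \<open>x\<close>. A
      minimum over \<open>K\<close> is therefore global.\<close>
    define K where "K = fst ` cut_off (paraboloid p) m c"
    have apex: "apex p m = x"
      using nz by (simp add: apex_def m_def vec_eq_iff)
    have K: "y \<in> K \<longleftrightarrow> paraboloid p y \<le> m \<bullet> y + c" for y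
      by (force simp: K_def cut_off_def image_iff)
    have "x \<in> K"
      using above[rule_format, of x] by (simp add: K c_def)
    have "compact K"
      unfolding K_def by (intro compact_continuous_image compact_cut_off[OF nz] continuous_intros)
    then obtain y where y: "y \<in> K" "\<And>z. z \<in> K \<Longrightarrow> f y - m \<bullet> y \<le> f z - m \<bullet> z"
      using continuous_attains_inf[of K "\<lambda>z. f z - m \<bullet> z"] \<open>x \<in> K\<close>
      by (fastforce intro: continuous_intros cont)
    have min: "f y - m \<bullet> y \<le> f z - m \<bullet> z" for z
    proof (cases "z \<in> K")
      case False
      then have "c < f z - m \<bullet> z"
        using above[rule_format, of z] by (simp add: K)
      then show ?thesis
        using y(2)[OF \<open>x \<in> K\<close>] by (simp add: c_def)
    qed (use y in simp)
    obtain m' where m': "(f has_derivative (\<lambda>h. m' \<bullet> h)) (at y)"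
      using diff by blast
    then have "((\<lambda>z. f z - m \<bullet> z) has_derivative (\<lambda>h. m' \<bullet> h - m \<bullet> h)) (at y)"
      by (auto intro!: derivative_eq_intros)
    \<comment> \<open>The derivative vanishes at the minimum, so the tangent plane of
      \<open>f\<close> at \<open>y\<close> has slope \<open>m\<close>.\<close>
    then have "(\<lambda>h. m' \<bullet> h - m \<bullet> h) = (\<lambda>h. 0)"
      by (rule has_derivative_local_min) (simp add: min)
    then have "m' = m"
      by (metis eq_iff_diff_eq_0 vector_eq_rdot)
    with m' have "height p m (f y - m \<bullet> y) = t"
      using height[of m y "f y - m \<bullet> y"] by simp
    \<comment> \<open>As \<open>x\<close> is the apex for slope \<open>m\<close>, this tangent plane
      passes exactly \<open>t\<close> above the paraboloid there.\<close>
    then have "m \<bullet> x + (f y - m \<bullet> y) = paraboloid p x + t"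
      using square[of m x "f y - m \<bullet> y"] by (simp add: apex)
    then show ?thesis
      using min[of x] by simp
  qed
  show "\<exists>k>0. k\<^sup>2 = inv_into {0..} (F p) V \<and> (\<forall>x. f x = paraboloid p x + k\<^sup>2)"
    using \<open>t > 0\<close> upper lower
    by (intro exI[of _ "sqrt t"]) (auto simp: t_def[symmetric] intro: antisym)
qed

end
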